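(* Let $G=G_1\nabla G_2$ be a Haj\'os join of two disjoint non-empty graphs $G_1$ and $G_2$. Then: (a) $\chi_2(G)\ge\min\{\chi_2(G_1),\chi_2(G_2)\}$; (b) if $\chi_2(G_1)=\chi_2(G_2)=k$ and $k\ge2$, then $\chi_2(G)=k$; (c) if both $G_1$ and $G_2$ belong to ${\rm Cri}_2(k)$ and $k\ge2$, then $G$ belongs to ${\rm Cri}_2(k)$; (d) if $G$ belongs to ${\rm Cri}_2(k)$ and $k\ge2$, then both $G_1$ and $G_2$ belong to ${\rm Cri}_2(k)$.
   Context: All graphs are finite, undirected, loopless, and may have multiple edges. Hajós join: let $G_1,G_2$ be disjoint graphs and for $i\in\{1,2\}$ let $u_i,v_i$ be distinct vertices of $G_i$ and $e_i$ an edge of $G_i$ joining $u_i$ and $v_i$. The graph $G_1\nabla G_2$ is obtained from $G_1\cup G_2$ by deleting $e_1$ and $e_2$, identifying $v_1$ with $v_2$, and adding one new edge between $u_1$ and $u_2$. $\chi_2(G)$ (point arboricity) is the least $k\ge0$ such that $V(G)$ can be colored with $k$ colors so that each color class induces a forest (a subgraph with no cycles, where two parallel edges form a cycle of length 2). $G$ is $\chi_2$-critical if $\chi_2(G')<\chi_2(G)$ for every proper subgraph $G'$; ${\rm Cri}_2(k)$ is the class of $\chi_2$-critical graphs with $\chi_2=k$. *)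

theory Defs
  imports "HOL-Library.Multiset"
begin

text \<open>
  Finite loopless multigraphs. Parallel edges have the same pair of ends, so the edges form a
  multiset of two-element vertex sets; the multiplicity of \<open>{x, y}\<close> is the number of edges
  joining \<open>x\<close> and \<open>y\<close>. The empty graph is allowed.
\<close>

record 'a mgraph =
  verts :: "'a set"
  edges :: "'a set multiset"

definition multigraph :: "'a mgraph \<Rightarrow> bool" where
  "multigraph G \<longleftrightarrow>
     finite (verts G) \<and> (\<forall>e. e \<in># edges G \<longrightarrow> e \<subseteq> verts G \<and> card e = 2)"

definition subgraph :: "'a mgraph \<Rightarrow> 'a mgraph \<Rightarrow> bool" where
  "subgraph H G \<longleftrightarrow> multigraph H \<and> verts H \<subseteq> verts G \<and> edges H \<subseteq># edges G"

definition proper_subgraph :: "'a mgraph \<Rightarrow> 'a mgraph \<Rightarrow> bool" where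
  "proper_subgraph H G \<longleftrightarrow> subgraph H G \<and> H \<noteq> G"

definition induced :: "'a mgraph \<Rightarrow> 'a set \<Rightarrow> 'a mgraph" where
  "induced G X = \<lparr>verts = X, edges = filter_mset (\<lambda>e. e \<subseteq> X) (edges G)\<rparr>"

text \<open>
  The edges \<open>{x\<^sub>1, x\<^sub>2}, \<dots>, {x\<^sub>n, x\<^sub>1}\<close> of a cycle are counted with multiplicity: for
  \<open>n = 2\<close> the condition \<open>cycle_edges [x, y] \<subseteq># edges G\<close> asks for two parallel edges between
  \<open>x\<close> and \<open>y\<close>, and for \<open>n \<ge> 3\<close> these edges are pairwise different.
\<close>

definition cycle_edges :: "'a list \<Rightarrow> 'a set multiset" where
  "cycle_edges xs = mset (map2 (\<lambda>x y. {x, y}) xs (rotate1 xs))"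

definition is_cycle :: "'a mgraph \<Rightarrow> 'a list \<Rightarrow> bool" where
  "is_cycle G xs \<longleftrightarrow>
     length xs \<ge> 2 \<and> distinct xs \<and> set xs \<subseteq> verts G \<and> cycle_edges xs \<subseteq># edges G"

definition forest :: "'a mgraph \<Rightarrow> bool" where
  "forest G \<longleftrightarrow> (\<nexists>xs. is_cycle G xs)"

definition forest_coloring :: "'a mgraph \<Rightarrow> nat \<Rightarrow> ('a \<Rightarrow> nat) \<Rightarrow> bool" where
  "forest_coloring G k c \<longleftrightarrow>
     (\<forall>x\<in>verts G. c x < k) \<and> (\<forall>i<k. forest (induced G {x \<in> verts G. c x = i}))"

definition point_arboricity :: "'a mgraph \<Rightarrow> nat" (\<open>\<chi>\<^sub>2\<close>) where
  "\<chi>\<^sub>2 G = (LEAST k. \<exists>c. forest_coloring G k c)"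

lemma ex_forest_coloring:
  assumes "multigraph G"
  shows "\<exists>k c. forest_coloring G k c"
proof -
  have "finite (verts G)"
    using assms by (simp add: multigraph_def)
  then obtain c :: "'a \<Rightarrow> nat" and k where c: "c ` verts G = {..<k}" "inj_on c (verts G)"
    using finite_imp_inj_to_nat_seg[of "verts G"] by (auto simp: lessThan_def)
  have "forest (induced G {x \<in> verts G. c x = i})" for i
  proof -
    have False if cyc: "is_cycle (induced G {x \<in> verts G. c x = i}) xs" for xs
    proof -
      have "card (set xs) \<ge> 2" and sub: "set xs \<subseteq> {x \<in> verts G. c x = i}"
        using cyc by (auto simp: is_cycle_def induced_def distinct_card)
      then obtain x y where "x \<in> set xs" "y \<in> set xs" "x \<noteq> y"
        by (meson card_2_iff' obtain_subset_with_card_n subsetD)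
      with sub c(2) show False
        by (auto simp: inj_on_def)
    qed
    then show ?thesis
      by (auto simp: forest_def)
  qed
  with c(1) have "forest_coloring G k c"
    by (auto simp: forest_coloring_def)
  then show ?thesis
    by blast
qed

definition critical :: "'a mgraph \<Rightarrow> bool" where
  "critical G \<longleftrightarrow> (\<forall>H. proper_subgraph H G \<longrightarrow> \<chi>\<^sub>2 H < \<chi>\<^sub>2 G)"

definition Cri\<^sub>2 :: "nat \<Rightarrow> 'a mgraph set" where
  "Cri\<^sub>2 k = {G. multigraph G \<and> critical G \<and> \<chi>\<^sub>2 G = k}"

definition disjoint_graphs :: "'a mgraph \<Rightarrow> 'a mgraph \<Rightarrow> bool" where
  "disjoint_graphs G H \<longleftrightarrow> verts G \<inter> verts H = {}"

definition graph_union :: "'a mgraph \<Rightarrow> 'a mgraph \<Rightarrow> 'a mgraph" where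
  "graph_union G H = \<lparr>verts = verts G \<union> verts H, edges = edges G + edges H\<rparr>"

definition delete_edge :: "'a set \<Rightarrow> 'a mgraph \<Rightarrow> 'a mgraph" where
  "delete_edge e G = \<lparr>verts = verts G, edges = edges G - {#e#}\<rparr>"

definition add_edge :: "'a set \<Rightarrow> 'a mgraph \<Rightarrow> 'a mgraph" where
  "add_edge e G = \<lparr>verts = verts G, edges = edges G + {#e#}\<rparr>"

definition identify :: "'a \<Rightarrow> 'a \<Rightarrow> 'a \<Rightarrow> 'a mgraph \<Rightarrow> 'a mgraph" where
  "identify x y w G =
     (let f = (\<lambda>z. if z = x \<or> z = y then w else z)
      in \<lparr>verts = f ` verts G, edges = image_mset (image f) (edges G)\<rparr>)"

text \<open>
  The vertex \<open>w\<close> resulting from the identification of \<open>v1\<close> and \<open>v2\<close> may carry any name not used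
  by the remaining vertices (in particular \<open>v1\<close> or \<open>v2\<close>). Deleting \<open>{u1, v1}\<close> removes one edge
  only; edges parallel to it are kept.
\<close>

definition hajos_join :: "'a mgraph \<Rightarrow> 'a mgraph \<Rightarrow> 'a mgraph \<Rightarrow> bool" where
  "hajos_join G1 G2 G \<longleftrightarrow>
     (\<exists>u1 v1 u2 v2 w.
        u1 \<in> verts G1 \<and> v1 \<in> verts G1 \<and> u1 \<noteq> v1 \<and> {u1, v1} \<in># edges G1 \<and>
        u2 \<in> verts G2 \<and> v2 \<in> verts G2 \<and> u2 \<noteq> v2 \<and> {u2, v2} \<in># edges G2 \<and>
        w \<notin> (verts G1 \<union> verts G2) - {v1, v2} \<and>
        G = add_edge {u1, u2} (identify v1 v2 w
              (delete_edge {u1, v1} (delete_edge {u2, v2} (graph_union G1 G2)))))"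

end

theory Submission
  imports Defs "HOL-Combinatorics.Transposition"
begin

text \<open>
  A multigraph is a forest iff no edge \<open>{x, y}\<close> leaves its ends connected when it is removed. Since
  the colour is constant along a monochromatic path, a colouring has forests as colour classes iff
  the multiset of all monochromatic edges is acyclic in this sense. Write \<open>F\<^sub>i = E\<^sub>i - {u\<^sub>i v\<^sub>i}\<close>.
  A monochromatic cycle of the join through the new edge consists of that edge and two
  monochromatic paths, one from \<open>u\<^sub>i\<close> to \<open>v\<^sub>i\<close> in each \<open>F\<^sub>i\<close>. Hence a colouring of the join is good
  for \<open>G\<^sub>1\<close> or for \<open>G\<^sub>2\<close>, and conversely a good colouring of \<open>G\<^sub>1\<close> can be glued to a good colouring of
  \<open>F\<^sub>2\<close> alone after the colours are permuted to agree at the common vertex. With at least one colour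
  colourability depends on the edges only, and a graph is critical iff removing any edge makes it
  colourable with fewer colours and no vertex is isolated.
\<close>

section \<open>Acyclic edge multisets\<close>

definition conn :: "'a set multiset \<Rightarrow> ('a \<times> 'a) set" where
  "conn E = {(x, y). {x, y} \<in># E}\<^sup>*"

text \<open>Only one copy of the edge is removed, so two parallel edges already violate the
  condition, as a cycle of length 2 should.\<close>

definition acyc :: "'a set multiset \<Rightarrow> bool" where
  "acyc E \<longleftrightarrow> (\<forall>x y. {x, y} \<in># E \<longrightarrow> (x, y) \<notin> conn (E - {#{x, y}#}))"

lemma conn_refl [simp]: "(x, x) \<in> conn E"
  by (simp add: conn_def)

lemma conn_edge: "{x, y} \<in># E \<Longrightarrow> (x, y) \<in> conn E"
  by (auto simp: conn_def)

lemma conn_trans: "(x, y) \<in> conn E \<Longrightarrow> (y, z) \<in> conn E \<Longrightarrow> (x, z) \<in> conn E"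
  unfolding conn_def by (rule rtrancl_trans)

lemma conn_sym: "(x, y) \<in> conn E \<Longrightarrow> (y, x) \<in> conn E"
proof -
  have "sym {(x, y). {x, y} \<in># E}"
    by (auto simp: sym_def insert_commute)
  then show "(x, y) \<in> conn E \<Longrightarrow> (y, x) \<in> conn E"
    unfolding conn_def by (meson sym_rtrancl symD)
qed

lemma conn_mono:
  assumes "A \<subseteq># B" and "(x, y) \<in> conn A"
  shows "(x, y) \<in> conn B"
proof -
  have "{(x, y). {x, y} \<in># A} \<subseteq> {(x, y). {x, y} \<in># B}"
    using assms(1) by (auto dest: mset_subset_eqD)
  from rtrancl_mono[OF this] show ?thesis
    using assms(2) by (auto simp: conn_def)
qed

lemma conn_induct [consumes 1, case_names refl step]:
  assumes "(x, y) \<in> conn E"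
    and "P x"
    and "\<And>y z. (x, y) \<in> conn E \<Longrightarrow> {y, z} \<in># E \<Longrightarrow> P y \<Longrightarrow> P z"
  shows "P y"
  using assms(1) unfolding conn_def
  by (induction rule: rtrancl_induct) (use assms(2,3) in \<open>auto simp: conn_def\<close>)

lemma conn_end:
  assumes "(x, y) \<in> conn E" and "x \<noteq> y"
  shows "y \<in> \<Union>(set_mset E)"
  using assms by (induction rule: conn_induct) auto

text \<open>A walk need cross the new edge at most once; the last two cases are the two directions
  of the crossing.\<close>

lemma conn_add_mset:
  assumes "(x, y) \<in> conn (add_mset {u, v} E)"
  shows "(x, y) \<in> conn E \<or> (x, u) \<in> conn E \<and> (v, y) \<in> conn E
    \<or> (x, v) \<in> conn E \<and> (u, y) \<in> conn E"
  using assms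
proof (induction rule: conn_induct)
  case (step y z)
  consider "{y, z} \<in># E" | "y = u" "z = v" | "y = v" "z = u"
    using step.hyps by (auto simp: doubleton_eq_iff)
  then show ?case
  proof cases
    case 1
    then show ?thesis
      using step.IH conn_edge conn_trans by meson
  next
    \<comment> \<open>The last step is the new edge: either \<open>E\<close> alone already leads
      from \<open>x\<close> to \<open>z\<close>, or it leads to \<open>y\<close> and the part after
      the crossing is trivial.\<close>
    case 2
    then show ?thesis
      using step.IH conn_sym conn_trans conn_refl by metis
  next
    case 3
    then show ?thesis
      using step.IH conn_sym conn_trans conn_refl by metis
  qed
qed simp

lemma acyc_subset:
  assumes "A \<subseteq># B" and "acyc B"
  shows "acyc A"
proof -
  have "A - {#e#} \<subseteq># B - {#e#}" for e
    using assms(1) by (simp add: subseteq_mset_def diff_le_mono)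
  then show ?thesis
    using assms unfolding acyc_def by (meson conn_mono mset_subset_eqD)
qed

text \<open>Allows acyclicity to be checked edge by edge: a cycle through the new edge, less that
  edge, is a path from \<open>u\<close> to \<open>v\<close> in \<open>E\<close>.\<close>

lemma acyc_add_mset: "acyc (add_mset {u, v} E) \<longleftrightarrow> acyc E \<and> (u, v) \<notin> conn E"
proof (intro iffI conjI)
  assume *: "acyc (add_mset {u, v} E)"
  then show "acyc E"
    by (rule acyc_subset[rotated]) simp
  show "(u, v) \<notin> conn E"
    using * by (auto simp: acyc_def)
next
  assume E: "acyc E \<and> (u, v) \<notin> conn E"
  show "acyc (add_mset {u, v} E)"
    unfolding acyc_def
  proof (intro allI impI notI)
    fix x y
    assume xy: "{x, y} \<in># add_mset {u, v} E" "(x, y) \<in> conn (add_mset {u, v} E - {#{x, y}#})"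
    show False
    proof (cases "{x, y} = {u, v}")
      case True
      then show False
        using xy E by (auto simp: doubleton_eq_iff insert_commute dest: conn_sym)
    next
      case False
      let ?D = "E - {#{x, y}#}"
      have in_E: "{x, y} \<in># E"
        using xy False by auto
      have "(x, y) \<in> conn (add_mset {u, v} ?D)"
        using xy False by simp
      moreover have "(x, y) \<notin> conn ?D"
        using in_E E by (auto simp: acyc_def)
      ultimately consider "(x, u) \<in> conn ?D" "(v, y) \<in> conn ?D" | "(x, v) \<in> conn ?D" "(u, y) \<in> conn ?D"
        using conn_add_mset by metis
      moreover have "(a, b) \<in> conn E" if "(a, b) \<in> conn ?D" for a b
        using that by (rule conn_mono[rotated]) simp
      \<comment> \<open>The return path of \<open>{x, y}\<close> crosses the new edge; its two
        pieces, linked by \<open>{x, y}\<close> itself, connect \<open>u\<close> and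
        \<open>v\<close>.\<close>
      ultimately have "(u, v) \<in> conn E"
        using conn_edge[OF in_E] conn_sym conn_trans by metis
      then show False
        using E by simp
    qed
  qed
qed

text \<open>Collapse everything outside \<open>U\<close> to \<open>w\<close>. Edges of
  \<open>A\<close> stay, and an edge of \<open>B\<close> shrinks to \<open>w\<close>, since each of
  its ends is \<open>w\<close> or outside \<open>U\<close>.\<close>

lemma conn_retract:
  assumes "(x, y) \<in> conn (A + B)"
    and "\<forall>e\<in>#A. e \<subseteq> U" and "\<forall>e\<in>#B. e \<subseteq> V" and "U \<inter> V \<subseteq> {w}"
  shows "(if x \<in> U then x else w, if y \<in> U then y else w) \<in> conn A"
  using assms(1)
proof (induction rule: conn_induct)
  case (step y z)
  from step.hyps have "{y, z} \<in># A \<or> {y, z} \<in># B"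
    by simp
  then have "(if y \<in> U then y else w, if z \<in> U then z else w) \<in> conn A"
  proof
    assume "{y, z} \<in># A"
    then show ?thesis
      using assms(2) by (auto intro: conn_edge)
  next
    assume "{y, z} \<in># B"
    then have "y \<in> V" "z \<in> V"
      using assms(3) by auto
    then have "y \<in> U \<Longrightarrow> y = w" "z \<in> U \<Longrightarrow> z = w"
      using assms(4) by auto
    then show ?thesis
      by auto
  qed
  then show ?case
    using step.IH by (rule conn_trans[rotated])
qed simp

text \<open>The edges of \<open>B\<close> are added one by one. A path in \<open>A + B\<close>
  between the ends of such an edge retracts to a path in \<open>B\<close>, by
  \<open>conn_retract\<close> with the sides exchanged.\<close>

lemma acyc_union:
  assumes "acyc A" and "acyc B"
    and "\<forall>e\<in>#A. e \<subseteq> U" and "\<forall>e\<in>#B. e \<subseteq> V" and "U \<inter> V \<subseteq> {w}"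
    and "\<forall>e\<in>#B. card e = 2"
  shows "acyc (A + B)"
  using assms(2,4,6)
proof (induction B)
  case (add e B)
  obtain x y where e: "e = {x, y}"
    using add.prems(3) by (auto simp: card_2_iff)
  have xy: "x \<in> V" "y \<in> V"
    using add.prems(2) e by auto
  have B: "acyc B" "(x, y) \<notin> conn B"
    using add.prems(1) e by (auto simp: acyc_add_mset)
  have "(x, y) \<notin> conn (A + B)"
    using conn_retract[of x y B A V U w] add.prems(2) assms(3,5) B(2) xy
    by (auto simp: union_commute)
  moreover have "acyc (A + B)"
    using add B by auto
  ultimately show ?case
    by (simp add: e acyc_add_mset)
qed (use assms(1) in simp)

section \<open>Cycles and forests\<close>

text \<open>Edges of an open walk; \<open>cycle_edges\<close> has the closing edge in
  addition.\<close>

fun walk_edges :: "'a list \<Rightarrow> 'a set multiset" where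
  "walk_edges (x # y # zs) = add_mset {x, y} (walk_edges (y # zs))"
| "walk_edges _ = {#}"

text \<open>The final entry \<open>z\<close> is independent of the head, so that the induction may
  change the head.\<close>

lemma mset_map2_walk_edges:
  "mset (map2 (\<lambda>x y. {x, y}) (x # ys) (ys @ [z])) = add_mset {last (x # ys), z} (walk_edges (x # ys))"
  by (induction ys arbitrary: x) auto

lemma cycle_edges_Cons: "cycle_edges (x # ys) = add_mset {last (x # ys), x} (walk_edges (x # ys))"
  using mset_map2_walk_edges[of x ys x] by (simp add: cycle_edges_def)

lemma walk_edges_subset_set: "e \<in># walk_edges xs \<Longrightarrow> e \<subseteq> set xs"
  by (induction xs rule: walk_edges.induct) auto

lemma walk_edges_suffix: "walk_edges ys \<subseteq># walk_edges (xs @ ys)"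
proof (induction xs)
  case (Cons x xs)
  have "walk_edges (xs @ ys) \<subseteq># walk_edges (x # xs @ ys)"
    by (cases "xs @ ys") auto
  then show ?case
    using Cons by (auto intro: subset_mset.order_trans)
qed simp

lemma conn_walk: "walk_edges (x # ys) \<subseteq># E \<Longrightarrow> (x, last (x # ys)) \<in> conn E"
proof (induction ys arbitrary: x)
  case (Cons y ys)
  then have "{x, y} \<in># E" "walk_edges (y # ys) \<subseteq># E"
    by (auto dest: mset_subset_eq_insertD intro: subset_mset.order_trans[OF _ Cons.prems])
  then show ?case
    using Cons.IH conn_edge conn_trans by fastforce
qed simp

text \<open>Vertices are prepended one at a time; if the new one already occurs, only the suffix
  starting with it is kept.\<close>

lemma conn_path:
  assumes "(x, y) \<in> conn E"
  shows "\<exists>ys. last (x # ys) = y \<and> distinct (x # ys) \<and> walk_edges (x # ys) \<subseteq># E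
    \<and> set ys \<subseteq> \<Union>(set_mset E)"
  using assms unfolding conn_def
proof (induction rule: converse_rtrancl_induct)
  case base
  show ?case
    by (intro exI[of _ "[]"]) simp
next
  case (step x z)
  then obtain ys where ys: "last (z # ys) = y" "distinct (z # ys)" "walk_edges (z # ys) \<subseteq># E"
    "set ys \<subseteq> \<Union>(set_mset E)"
    by auto
  have xz: "{x, z} \<in># E"
    using step.hyps by simp
  show ?case
  proof (cases "x \<in> set (z # ys)")
    case True
    then obtain as bs where split: "z # ys = as @ x # bs"
      by (meson split_list)
    have "walk_edges (x # bs) \<subseteq># E"
      using ys(3) walk_edges_suffix[of "x # bs" as] split
      by (auto intro: subset_mset.order_trans)
    moreover have "set bs \<subseteq> set ys"
      using split by (cases as) auto
    moreover have "last (x # bs) = y"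
      using ys(1) split by simp
    moreover have "distinct (x # bs)"
      using ys(2) split by simp
    ultimately show ?thesis
      using ys(4) by blast
  next
    case False
    \<comment> \<open>As \<open>x\<close> is new, the rest of the path does not use
      \<open>{x, z}\<close>, so one copy of it in \<open>E\<close> suffices.\<close>
    then have "{x, z} \<notin># walk_edges (z # ys)"
      using walk_edges_subset_set by fastforce
    then have "walk_edges (x # z # ys) \<subseteq># E"
      using ys(3) xz by (auto simp: subseteq_mset_def Suc_le_eq not_in_iff)
    then show ?thesis
      using ys False xz by (intro exI[of _ "z # ys"]) auto
  qed
qed

text \<open>A simple return path closed by the removed edge is a cycle; a cycle less its closing
  edge is a return path.\<close>

lemma forest_iff_acyc:
  assumes "\<forall>e\<in>#edges G. e \<subseteq> verts G \<and> card e = 2"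
  shows "forest G \<longleftrightarrow> acyc (edges G)"
proof
  assume forest: "forest G"
  show "acyc (edges G)"
    unfolding acyc_def
  proof (intro allI impI notI)
    fix x y
    assume xy: "{x, y} \<in># edges G" and path: "(x, y) \<in> conn (edges G - {#{x, y}#})"
    obtain ys where ys: "last (x # ys) = y" "distinct (x # ys)"
      "walk_edges (x # ys) \<subseteq># edges G - {#{x, y}#}" "set ys \<subseteq> \<Union>(set_mset (edges G - {#{x, y}#}))"
      using conn_path[OF path] by blast
    have "card {x, y} = 2" "{x, y} \<subseteq> verts G"
      using assms xy by auto
    \<comment> \<open>\<open>card {x, y} = 2\<close> excludes \<open>x = y\<close>, so the cycle has
      at least two vertices.\<close>
    then have "ys \<noteq> []" "x \<in> verts G"
      using ys(1) by auto
    moreover have "set ys \<subseteq> verts G"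
      using ys(4) assms by (auto dest!: in_diffD)
    moreover have "cycle_edges (x # ys) \<subseteq># edges G"
      using ys(1,3) xy by (simp add: cycle_edges_Cons insert_subset_eq_iff insert_commute)
    ultimately have "is_cycle G (x # ys)"
      using ys(2) by (auto simp: is_cycle_def Suc_le_eq)
    then show False
      using forest by (auto simp: forest_def)
  qed
next
  assume acyc: "acyc (edges G)"
  have False if cyc: "is_cycle G xs" for xs
  proof -
    obtain x ys where xs: "xs = x # ys"
      using cyc by (cases xs) (auto simp: is_cycle_def)
    let ?e = "{x, last (x # ys)}"
    have "?e \<in># edges G" "walk_edges (x # ys) \<subseteq># edges G - {#?e#}"
      using cyc unfolding xs is_cycle_def cycle_edges_Cons
      by (auto simp: insert_subset_eq_iff insert_commute)
    then show False
      using conn_walk[of x ys] acyc unfolding acyc_def by blast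
  qed
  then show "forest G"
    by (auto simp: forest_def)
qed

section \<open>Monochromatic edges and colourability\<close>

definition mono_edges :: "('a \<Rightarrow> 'b) \<Rightarrow> 'a set multiset \<Rightarrow> 'a set multiset" where
  "mono_edges c E = filter_mset (\<lambda>e. \<forall>x\<in>e. \<forall>y\<in>e. c x = c y) E"

definition colorable :: "nat \<Rightarrow> 'a set multiset \<Rightarrow> bool" where
  "colorable k E \<longleftrightarrow> (\<exists>c. (\<forall>x. c x < k) \<and> acyc (mono_edges c E))"

lemma mono_edges_union [simp]: "mono_edges c (A + B) = mono_edges c A + mono_edges c B"
  by (simp add: mono_edges_def)

lemma mono_edges_add_edge [simp]:
  "mono_edges c (add_mset {x, y} E)
    = (if c x = c y then add_mset {x, y} (mono_edges c E) else mono_edges c E)"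
  by (auto simp: mono_edges_def)

lemma in_mono_edges_iff: "e \<in># mono_edges c E \<longleftrightarrow> e \<in># E \<and> (\<forall>x\<in>e. \<forall>y\<in>e. c x = c y)"
  by (simp add: mono_edges_def)

lemma doubleton_in_mono_edges_iff: "{x, y} \<in># mono_edges c E \<longleftrightarrow> {x, y} \<in># E \<and> c x = c y"
  unfolding in_mono_edges_iff by (metis insertE insertI1 insertI2 singletonD)

text \<open>Only the equality pattern of the colours on each edge counts; this serves to permute
  colours and to recolour vertices outside the graph.\<close>

lemma mono_edges_cong:
  assumes "\<And>e x y. e \<in># E \<Longrightarrow> x \<in> e \<Longrightarrow> y \<in> e \<Longrightarrow> c x = c y \<longleftrightarrow> d x = d y"
  shows "mono_edges c E = mono_edges d E"
  unfolding mono_edges_def using assms by (intro filter_mset_cong) auto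

lemma conn_mono_edges_color: "(x, y) \<in> conn (mono_edges c E) \<Longrightarrow> c x = c y"
  by (induction rule: conn_induct) (auto simp: doubleton_in_mono_edges_iff)

lemma colorable_subset:
  assumes "colorable k B" and "A \<subseteq># B"
  shows "colorable k A"
  using assms unfolding colorable_def mono_edges_def
  by (meson acyc_subset multiset_filter_mono)

text \<open>The fresh colour \<open>m\<close> on \<open>x\<close> alone makes all edges at
  \<open>x\<close> bichromatic and leaves the other edges as they were.\<close>

lemma colorable_Suc:
  assumes "colorable m E" and "\<forall>e\<in>#E. card e = 2" and "x \<noteq> y"
  shows "colorable (Suc m) (add_mset {x, y} E)"
proof -
  obtain c where c: "\<forall>x. c x < m" "acyc (mono_edges c E)"
    using assms(1) by (auto simp: colorable_def)
  let ?c = "c(x := m)"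
  have neq: "?c z \<noteq> m" if "z \<noteq> x" for z
    using c(1) that by (metis fun_upd_other nat_neq_iff)
  have "mono_edges ?c E \<subseteq># mono_edges c E"
    unfolding mono_edges_def
  proof (rule filter_mset_mono_strong)
    fix e
    assume e: "e \<in># E" "\<forall>p\<in>e. \<forall>q\<in>e. ?c p = ?c q"
    obtain a b where ab: "e = {a, b}" "a \<noteq> b"
      using assms(2) e(1) by (auto simp: card_2_iff)
    then have eq: "?c a = ?c b"
      using e(2) by blast
    then have "a \<noteq> x" "b \<noteq> x"
      using neq[of a] neq[of b] ab(2) by force+
    then have "c a = c b"
      using eq by simp
    then show "\<forall>p\<in>e. \<forall>q\<in>e. c p = c q"
      unfolding ab(1) by simp
  qed simp
  then have "acyc (mono_edges ?c E)"
    using c(2) by (rule acyc_subset)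
  moreover have "mono_edges ?c (add_mset {x, y} E) = mono_edges ?c E"
    using assms(3) neq[of y] unfolding mono_edges_add_edge by auto
  ultimately have "acyc (mono_edges ?c (add_mset {x, y} E))"
    by simp
  moreover have "\<forall>z. ?c z < Suc m"
    using c(1) by (simp add: less_Suc_eq)
  ultimately show ?thesis
    unfolding colorable_def by blast
qed

text \<open>A monochromatic path never leaves its colour class, so all classes can be tested for
  cycles at once.\<close>

lemma forest_coloring_iff:
  assumes "multigraph G"
  shows "forest_coloring G k c \<longleftrightarrow> (\<forall>x\<in>verts G. c x < k) \<and> acyc (mono_edges c (edges G))"
proof -
  define C where "C i = filter_mset (\<lambda>e. e \<subseteq> {x \<in> verts G. c x = i}) (edges G)" for i
  let ?M = "mono_edges c (edges G)"
  have forest: "forest (induced G {x \<in> verts G. c x = i}) \<longleftrightarrow> acyc (C i)" for i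
    using assms by (subst forest_iff_acyc) (auto simp: induced_def C_def multigraph_def)
  have C_filter: "C i = filter_mset (\<lambda>e. e \<subseteq> {x \<in> verts G. c x = i}) ?M" for i
    unfolding C_def mono_edges_def filter_filter_mset by (rule filter_mset_cong) auto
  have "acyc ?M" if k: "\<forall>x\<in>verts G. c x < k" and acyc: "\<forall>i<k. acyc (C i)"
    unfolding acyc_def
  proof (intro allI impI notI)
    fix x y
    assume xy: "{x, y} \<in># ?M" and path: "(x, y) \<in> conn (?M - {#{x, y}#})"
    have verts: "e \<subseteq> verts G" if "e \<in># ?M" for e
      using assms that by (auto simp: multigraph_def in_mono_edges_iff)
    have in_C: "{x, y} \<in># C (c x)"
      using xy verts[OF xy] doubleton_in_mono_edges_iff[of x y c "edges G"] by (simp add: C_filter)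
    \<comment> \<open>Induction along the return path: it keeps the colour of \<open>x\<close>, so
      each of its edges lies in the class \<open>C (c x)\<close>.\<close>
    have class_path: "c z = c x \<and> (x, z) \<in> conn (C (c x) - {#{x, y}#})"
      if "(x, z) \<in> conn (?M - {#{x, y}#})" for z
      using that
    proof (induction rule: conn_induct)
      case (step p q)
      have M: "{p, q} \<in># ?M"
        using step.hyps by (auto dest: in_diffD)
      then have "c q = c x"
        using step.IH doubleton_in_mono_edges_iff[of p q c "edges G"] by simp
      then have "{p, q} \<in># filter_mset (\<lambda>e. e \<subseteq> {z \<in> verts G. c z = c x}) (?M - {#{x, y}#})"
        using step.hyps(2) step.IH verts[OF M] by (simp del: filter_diff_mset)
      then have "{p, q} \<in># C (c x) - {#{x, y}#}"
        using in_C by (simp add: C_filter)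
      from conn_trans[OF conjunct2[OF step.IH] conn_edge[OF this]] \<open>c q = c x\<close> show ?case
        by (intro conjI)
    qed simp
    have "acyc (C (c x))"
      using acyc k verts[OF xy] by simp
    then have "(x, y) \<notin> conn (C (c x) - {#{x, y}#})"
      using in_C by (simp add: acyc_def)
    with class_path[OF path] show False
      by simp
  qed
  moreover have "acyc (C i)" if "acyc ?M" for i
    using that by (rule acyc_subset[rotated]) (simp add: C_filter)
  ultimately show ?thesis
    unfolding forest_coloring_def forest by blast
qed

lemma point_arboricity_le_iff:
  assumes "multigraph G" and "k \<ge> 1"
  shows "\<chi>\<^sub>2 G \<le> k \<longleftrightarrow> colorable k (edges G)"
proof
  assume le: "\<chi>\<^sub>2 G \<le> k"
  obtain c where "forest_coloring G (\<chi>\<^sub>2 G) c"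
    unfolding point_arboricity_def using LeastI_ex[OF ex_forest_coloring[OF assms(1)]] by blast
  then have c: "\<forall>x\<in>verts G. c x < k" "acyc (mono_edges c (edges G))"
    using le assms by (auto simp: forest_coloring_iff)
  \<comment> \<open>\<open>colorable\<close> bounds the colours everywhere; outside the graph the
    default 0 is below \<open>k\<close> because \<open>k \<ge> 1\<close>.\<close>
  let ?c = "\<lambda>x. if x \<in> verts G then c x else 0"
  have "mono_edges ?c (edges G) = mono_edges c (edges G)"
    using assms(1) by (intro mono_edges_cong) (auto simp: multigraph_def)
  then have "(\<forall>x. ?c x < k) \<and> acyc (mono_edges ?c (edges G))"
    using c assms(2) by auto
  then show "colorable k (edges G)"
    unfolding colorable_def by (rule exI[of _ ?c])
next
  assume "colorable k (edges G)"
  then have "\<exists>c. forest_coloring G k c"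
    using assms by (auto simp: colorable_def forest_coloring_iff)
  then show "\<chi>\<^sub>2 G \<le> k"
    unfolding point_arboricity_def by (rule Least_le)
qed

lemma point_arboricity_pos:
  assumes "multigraph G" and "verts G \<noteq> {}"
  shows "\<chi>\<^sub>2 G \<ge> 1"
proof -
  obtain c where "forest_coloring G (\<chi>\<^sub>2 G) c"
    unfolding point_arboricity_def using LeastI_ex[OF ex_forest_coloring[OF assms(1)]] by blast
  then show ?thesis
    using assms(2) by (force simp: forest_coloring_def)
qed

section \<open>Criticality in terms of edges\<close>

text \<open>The parameter is one less than the arboricity of the critical graph.\<close>

definition edge_critical :: "nat \<Rightarrow> 'a set multiset \<Rightarrow> bool" where
  "edge_critical m E \<longleftrightarrow> \<not> colorable m E \<and> (\<forall>e\<in>#E. colorable m (E - {#e#}))"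

text \<open>Deleting an edge or an isolated vertex gives a proper subgraph; without isolated
  vertices every proper subgraph misses a copy of an edge. For \<open>m = 0\<close> a single vertex
  would be a counterexample.\<close>

lemma Cri2_Suc_iff:
  assumes "multigraph G" and "m \<ge> 1"
  shows "G \<in> Cri\<^sub>2 (Suc m) \<longleftrightarrow> edge_critical m (edges G) \<and> verts G \<subseteq> \<Union>(set_mset (edges G))"
proof
  assume "G \<in> Cri\<^sub>2 (Suc m)"
  then have crit: "\<And>H. proper_subgraph H G \<Longrightarrow> \<chi>\<^sub>2 H \<le> m" and chi: "\<chi>\<^sub>2 G = Suc m"
    by (auto simp: Cri\<^sub>2_def critical_def less_Suc_eq_le)
  have sub: "colorable m (edges H)" if "proper_subgraph H G" for H
    using crit[OF that] that assms(2)
    by (subst point_arboricity_le_iff[symmetric]) (auto simp: proper_subgraph_def subgraph_def)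
  have nc: "\<not> colorable m (edges G)"
    using assms chi by (subst point_arboricity_le_iff[symmetric]) auto
  have "colorable m (edges G - {#e#})" if "e \<in># edges G" for e
  proof -
    have "edges (delete_edge e G) \<noteq> edges G"
      using that by (metis delete_edge_def insert_DiffM mgraph.select_convs(2) multi_self_add_other_not_self)
    then have neq: "delete_edge e G \<noteq> G"
      by auto
    have "proper_subgraph (delete_edge e G) G"
      using assms(1) neq
      by (auto simp: proper_subgraph_def subgraph_def multigraph_def delete_edge_def dest: in_diffD)
    from sub[OF this] show ?thesis
      by (simp add: delete_edge_def)
  qed
  moreover have "x \<in> \<Union>(set_mset (edges G))" if x: "x \<in> verts G" for x
  proof (rule ccontr)
    assume iso: "x \<notin> \<Union>(set_mset (edges G))"
    let ?H = "\<lparr>verts = verts G - {x}, edges = edges G\<rparr>"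
    have "?H \<noteq> G"
      using x by (metis Diff_iff insertI1 mgraph.select_convs(1))
    then have "proper_subgraph ?H G"
      using assms(1) iso by (auto simp: proper_subgraph_def subgraph_def multigraph_def)
    from sub[OF this] show False
      using nc by simp
  qed
  ultimately show "edge_critical m (edges G) \<and> verts G \<subseteq> \<Union>(set_mset (edges G))"
    using nc by (auto simp: edge_critical_def)
next
  assume *: "edge_critical m (edges G) \<and> verts G \<subseteq> \<Union>(set_mset (edges G))"
  then have nc: "\<not> colorable m (edges G)"
    and del: "\<And>e. e \<in># edges G \<Longrightarrow> colorable m (edges G - {#e#})"
    by (auto simp: edge_critical_def)
  have "colorable m {#}"
    using assms(2) unfolding colorable_def mono_edges_def acyc_def by (intro exI[of _ "\<lambda>_. 0"]) simp
  then have "edges G \<noteq> {#}"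
    using nc by auto
  then obtain e where e: "e \<in># edges G"
    by blast
  then obtain x y where xy: "e = {x, y}" "x \<noteq> y"
    using assms(1) by (auto simp: multigraph_def card_2_iff)
  \<comment> \<open>Putting one deleted edge back costs at most one colour, which gives the upper
    bound on the arboricity.\<close>
  have "colorable (Suc m) (add_mset {x, y} (edges G - {#e#}))"
    using del[OF e] assms(1) xy
    by (intro colorable_Suc) (auto simp: multigraph_def dest: in_diffD)
  then have "\<chi>\<^sub>2 G \<le> Suc m"
    using e xy assms(1) by (simp add: point_arboricity_le_iff)
  moreover have "\<not> \<chi>\<^sub>2 G \<le> m"
    using nc assms by (simp add: point_arboricity_le_iff)
  ultimately have chi: "\<chi>\<^sub>2 G = Suc m"
    by simp
  have "\<chi>\<^sub>2 H < \<chi>\<^sub>2 G" if H: "proper_subgraph H G" for H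
  proof -
    have sub: "multigraph H" "verts H \<subseteq> verts G" "edges H \<subseteq># edges G" "H \<noteq> G"
      using H by (auto simp: proper_subgraph_def subgraph_def)
    have "edges H \<noteq> edges G"
    proof
      assume eq: "edges H = edges G"
      have "\<Union>(set_mset (edges H)) \<subseteq> verts H"
        using sub(1) by (auto simp: multigraph_def)
      then have "verts H = verts G"
        using * sub(2) eq by auto
      then show False
        using sub(4) eq by simp
    qed
    then obtain e where e: "e \<in># edges G - edges H"
      using sub(3) by (metis Diff_eq_empty_iff_mset multiset_nonemptyE subset_mset.antisym)
    \<comment> \<open>Counted with multiplicity, \<open>H\<close> lacks at least one copy of
      \<open>e\<close>.\<close>
    then have "edges H \<subseteq># edges G - {#e#}"
      using sub(3) by (auto simp: subseteq_mset_def in_diff_count)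
    moreover have "e \<in># edges G"
      using e by (auto dest: in_diffD)
    ultimately have "colorable m (edges H)"
      using del colorable_subset by blast
    then show ?thesis
      using sub(1) assms(2) chi by (simp add: point_arboricity_le_iff less_Suc_eq_le)
  qed
  then show "G \<in> Cri\<^sub>2 (Suc m)"
    using assms(1) chi by (auto simp: Cri\<^sub>2_def critical_def)
qed

section \<open>Renaming vertices\<close>

lemma conn_image:
  assumes "(x, y) \<in> conn E"
  shows "(f x, f y) \<in> conn (image_mset (image f) E)"
  using assms
proof (induction rule: conn_induct)
  case (step y z)
  have "{f y, f z} \<in># image_mset (image f) E"
    using imageI[OF step.hyps(2), of "image f"] by simp
  then show ?case
    using step.IH conn_edge conn_trans by metis
qed simp

lemma acyc_image_imp:
  assumes "acyc (image_mset (image f) E)"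
  shows "acyc E"
  unfolding acyc_def
proof (intro allI impI notI)
  fix x y
  assume xy: "{x, y} \<in># E" and path: "(x, y) \<in> conn (E - {#{x, y}#})"
  obtain D where D: "E = add_mset {x, y} D"
    using xy by (metis insert_DiffM)
  have "(f x, f y) \<in> conn (image_mset (image f) D)"
    using path D by (simp add: conn_image)
  then show False
    using assms D by (simp add: acyc_add_mset)
qed

text \<open>A colouring of the image is pulled back to \<open>c \<circ> f\<close>; a monochromatic
  cycle would survive under \<open>f\<close>.\<close>

lemma colorable_image_imp:
  assumes "colorable k (image_mset (image f) E)"
  shows "colorable k E"
proof -
  obtain c where c: "\<forall>x. c x < k" "acyc (mono_edges c (image_mset (image f) E))"
    using assms by (auto simp: colorable_def)
  have "mono_edges c (image_mset (image f) E) = image_mset (image f) (mono_edges (c \<circ> f) E)"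
    by (simp add: mono_edges_def filter_mset_image_mset)
  then have "acyc (mono_edges (c \<circ> f) E)"
    using c(2) by (auto intro: acyc_image_imp)
  then show ?thesis
    using c(1) unfolding colorable_def by (metis comp_apply)
qed

lemma image_mset_image_inverse:
  assumes "inj_on f V" and "\<forall>e\<in>#E. e \<subseteq> V"
  shows "image_mset (image (inv_into V f)) (image_mset (image f) E) = E"
proof -
  have "image_mset (image (inv_into V f) \<circ> image f) E = image_mset id E"
    using assms by (intro image_mset_cong) (simp add: inv_into_image_cancel)
  then show ?thesis
    by (simp add: multiset.map_comp)
qed

text \<open>Colourings are pulled back along \<open>f\<close> in one direction and along
  \<open>inv_into V f\<close> in the other.\<close>

lemma colorable_image_iff:
  assumes "inj_on f V" and "\<forall>e\<in>#E. e \<subseteq> V"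
  shows "colorable k (image_mset (image f) E) \<longleftrightarrow> colorable k E"
  using colorable_image_imp image_mset_image_inverse[OF assms] by metis

lemma edge_critical_image_iff:
  assumes "inj_on f V" and "\<forall>e\<in>#E. e \<subseteq> V"
  shows "edge_critical m (image_mset (image f) E) \<longleftrightarrow> edge_critical m E"
proof -
  have "image_mset (image f) E - {#f ` e#} = image_mset (image f) (E - {#e#})" if "e \<in># E" for e
    using that by (simp add: image_mset_Diff)
  moreover have "\<forall>d\<in>#E - {#e#}. d \<subseteq> V" for e
    using assms(2) by (auto dest: in_diffD)
  ultimately have "colorable m (image_mset (image f) E - {#f ` e#}) \<longleftrightarrow> colorable m (E - {#e#})"
    if "e \<in># E" for e
    using colorable_image_iff[OF assms(1)] that by metis
  then show ?thesis
    using colorable_image_iff[OF assms] by (simp add: edge_critical_def)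
qed

section \<open>Haj\'os joins sharing a vertex\<close>

text \<open>\<open>F\<^sub>1\<close> and \<open>F\<^sub>2\<close> are the edges of the two graphs without \<open>u\<^sub>1w\<close> and \<open>u\<^sub>2w\<close>, respectively.\<close>

definition glued ::
    "'a set \<Rightarrow> 'a set \<Rightarrow> 'a \<Rightarrow> 'a \<Rightarrow> 'a \<Rightarrow> 'a set multiset \<Rightarrow> 'a set multiset \<Rightarrow> bool" where
  "glued V1 V2 u1 u2 w F1 F2 \<longleftrightarrow>
     V1 \<inter> V2 = {w} \<and> u1 \<in> V1 - {w} \<and> u2 \<in> V2 - {w} \<and>
     (\<forall>e\<in>#F1. e \<subseteq> V1 \<and> card e = 2) \<and> (\<forall>e\<in>#F2. e \<subseteq> V2 \<and> card e = 2)"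

lemma glued_sym: "glued V1 V2 u1 u2 w F1 F2 \<Longrightarrow> glued V2 V1 u2 u1 w F2 F1"
  by (auto simp: glued_def)

lemma glued_diff: "glued V1 V2 u1 u2 w F1 F2 \<Longrightarrow> glued V1 V2 u1 u2 w (F1 - A) F2"
  by (auto simp: glued_def dest: in_diffD)

text \<open>If a good colouring of the join failed on both sides, monochromatic paths from
  \<open>u1\<close> and from \<open>u2\<close> to \<open>w\<close> would close a cycle with the new
  edge.\<close>

lemma colorable_join_split:
  assumes "colorable k (add_mset {u1, u2} (F1 + F2))"
  shows "colorable k (add_mset {u1, w} F1) \<or> colorable k (add_mset {u2, w} F2)"
proof (rule ccontr)
  assume contr: "\<not> ?thesis"
  obtain c where c: "\<forall>x. c x < k" "acyc (mono_edges c (add_mset {u1, u2} (F1 + F2)))"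
    using assms by (auto simp: colorable_def)
  let ?M = "mono_edges c (F1 + F2)"
  have path: "c u = c w \<and> (u, w) \<in> conn ?M"
    if "\<not> colorable k (add_mset {u, w} F)" "F \<subseteq># F1 + F2" for u F
  proof -
    have sub: "mono_edges c F \<subseteq># ?M"
      unfolding mono_edges_def using that(2) by (rule multiset_filter_mono)
    have "acyc ?M"
      using c(2) by (rule acyc_subset[rotated]) simp
    then have "acyc (mono_edges c F)"
      using sub by (rule acyc_subset[rotated])
    \<comment> \<open>\<open>c\<close> is good for \<open>F\<close>, so only \<open>{u, w}\<close>
      can spoil it: its ends share a colour and are already connected.\<close>
    moreover have "\<not> acyc (mono_edges c (add_mset {u, w} F))"
      using that(1) c(1) unfolding colorable_def by blast
    ultimately show ?thesis
      using conn_mono[OF sub] by (auto simp: acyc_add_mset split: if_splits)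
  qed
  have 1: "c u1 = c w \<and> (u1, w) \<in> conn ?M"
    using contr by (intro path) auto
  have 2: "c u2 = c w \<and> (u2, w) \<in> conn ?M"
    using contr by (intro path) auto
  have "(u1, u2) \<in> conn ?M"
    using 1 2 conn_sym conn_trans by metis
  then show False
    using c(2) 1 2 by (simp add: acyc_add_mset)
qed

text \<open>In the second colouring the colours \<open>c1 w\<close> and \<open>c2 w\<close> are
  exchanged, so that both colourings agree at \<open>w\<close>, the only common vertex.\<close>

lemma align_colorings:
  assumes "glued V1 V2 u1 u2 w F1 F2"
    and "\<forall>x. c1 x < (k::nat)" and "\<forall>x. c2 x < k"
    and "\<forall>e\<in>#A. e \<subseteq> V1" and "\<forall>e\<in>#B. e \<subseteq> V2"
  obtains c where "\<forall>x. c x < k"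
    "mono_edges c A = mono_edges c1 A" "mono_edges c B = mono_edges c2 B"
proof
  let ?p = "transpose (c1 w) (c2 w)"
  let ?c = "\<lambda>x. if x \<in> V1 then c1 x else ?p (c2 x)"
  show "\<forall>x. ?c x < k"
    using assms(2,3) by (simp add: transpose_def)
  show "mono_edges ?c A = mono_edges c1 A"
    using assms(4) by (intro mono_edges_cong) (auto dest!: bspec)
  have "x = w" if "x \<in> V1" "x \<in> V2" for x
    using assms(1) that by (auto simp: glued_def)
  then have "?c x = ?p (c2 x)" if "x \<in> V2" for x
    using that by auto
  then have "?c x = ?c y \<longleftrightarrow> c2 x = c2 y" if "x \<in> V2" "y \<in> V2" for x y
    using that by (metis transpose_eq_imp_eq)
  then show "mono_edges ?c B = mono_edges c2 B"
    using assms(5) by (intro mono_edges_cong) (meson subsetD)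
qed

lemma colorable_union:
  assumes glued: "glued V1 V2 u1 u2 w F1 F2"
    and "colorable k F1" and "colorable k F2"
  shows "colorable k (F1 + F2)"
proof -
  obtain c1 c2 where c12: "\<forall>x. c1 x < k" "acyc (mono_edges c1 F1)"
    "\<forall>x. c2 x < k" "acyc (mono_edges c2 F2)"
    using assms(2,3) by (auto simp: colorable_def)
  obtain c where c: "\<forall>x. c x < k"
    "mono_edges c F1 = mono_edges c1 F1" "mono_edges c F2 = mono_edges c2 F2"
    by (rule align_colorings[OF glued c12(1,3), of F1 F2]) (use glued in \<open>auto simp: glued_def\<close>)
  have "acyc (mono_edges c F1 + mono_edges c F2)"
    using glued c c12 by (intro acyc_union[of _ _ V1 V2 w]) (auto simp: glued_def in_mono_edges_iff)
  then show ?thesis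
    using c(1) by (auto simp: colorable_def)
qed

text \<open>After alignment at \<open>w\<close>, a monochromatic cycle through the new edge would
  contract to one through \<open>{u1, w}\<close> in the first graph. Of the second graph only
  \<open>F2\<close> has to be coloured.\<close>

lemma colorable_join:
  assumes glued: "glued V1 V2 u1 u2 w F1 F2"
    and "colorable k (add_mset {u1, w} F1)" and "colorable k F2"
  shows "colorable k (add_mset {u1, u2} (F1 + F2))"
proof -
  obtain c1 c2 where c12: "\<forall>x. c1 x < k" "acyc (mono_edges c1 (add_mset {u1, w} F1))"
    "\<forall>x. c2 x < k" "acyc (mono_edges c2 F2)"
    using assms(2,3) by (auto simp: colorable_def)
  obtain c where c: "\<forall>x. c x < k"
    "mono_edges c (add_mset {u1, w} F1) = mono_edges c1 (add_mset {u1, w} F1)"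
    "mono_edges c F2 = mono_edges c2 F2"
    by (rule align_colorings[OF glued c12(1,3), of "add_mset {u1, w} F1" F2])
       (use glued in \<open>auto simp: glued_def\<close>)
  let ?M1 = "mono_edges c F1" and ?M2 = "mono_edges c F2"
  have acyc: "acyc (mono_edges c (add_mset {u1, w} F1))"
    using c(2) c12(2) by simp
  then have M1: "acyc ?M1"
    by (rule acyc_subset[rotated]) simp
  have V: "\<forall>e\<in>#?M1. e \<subseteq> V1" "\<forall>e\<in>#?M2. e \<subseteq> V2" "V1 \<inter> V2 \<subseteq> {w}"
    using glued by (auto simp: glued_def in_mono_edges_iff)
  have union: "acyc (?M1 + ?M2)"
    using glued c c12 M1 V by (intro acyc_union[of _ _ V1 V2 w]) (auto simp: glued_def in_mono_edges_iff)
  have "(u1, u2) \<notin> conn (?M1 + ?M2)"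
  proof
    assume "(u1, u2) \<in> conn (?M1 + ?M2)"
    \<comment> \<open>The retraction to \<open>V1\<close> fixes \<open>u1\<close> and sends
      \<open>u2\<close>, which lies outside \<open>V1\<close>, to \<open>w\<close>.\<close>
    from conn_retract[OF this V] have path: "(u1, w) \<in> conn ?M1"
      using glued by (auto simp: glued_def split: if_splits)
    \<comment> \<open>The path has one colour, so \<open>{u1, w}\<close> is monochromatic and closes
      it to a cycle.\<close>
    then show False
      using acyc conn_mono_edges_color[OF path] by (simp add: acyc_add_mset)
  qed
  then have "acyc (mono_edges c (add_mset {u1, u2} (F1 + F2)))"
    using union by (simp add: acyc_add_mset)
  then show ?thesis
    using c(1) unfolding colorable_def by blast
qed

lemma add_mset_union_diff:
  "e \<in># A \<Longrightarrow> add_mset a (A + B) - {#e#} = add_mset a ((A - {#e#}) + B)"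
  by (auto simp: multiset_eq_iff)

text \<open>Without the new edge, colourings of \<open>F1\<close> and \<open>F2\<close> are glued.
  Without an edge of one side, that side becomes colourable together with its edge at
  \<open>w\<close>, and \<open>colorable_join\<close> applies.\<close>

lemma edge_critical_join:
  assumes glued: "glued V1 V2 u1 u2 w F1 F2"
    and crit1: "edge_critical m (add_mset {u1, w} F1)"
    and crit2: "edge_critical m (add_mset {u2, w} F2)"
  shows "edge_critical m (add_mset {u1, u2} (F1 + F2))"
proof -
  have F: "colorable m F1" "colorable m F2"
    using crit1 crit2 by (auto simp: edge_critical_def)
  have side: "colorable m (add_mset {u, v} (A + B) - {#e#})"
    if g: "glued V W u v w A B" and crit: "edge_critical m (add_mset {u, w} A)"
      and B: "colorable m B" and e: "e \<in># A" for V W u v A B e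
  proof -
    have "colorable m (add_mset {u, w} (A - {#e#}))"
      using crit e add_mset_union_diff[OF e, of _ "{#}"] by (auto simp: edge_critical_def)
    from colorable_join[OF glued_diff[OF g] this B] show ?thesis
      by (simp add: add_mset_union_diff[OF e])
  qed
  have "colorable m (add_mset {u1, u2} (F1 + F2) - {#e#})"
    if e: "e \<in># add_mset {u1, u2} (F1 + F2)" for e
  proof -
    consider "e = {u1, u2}" | "e \<in># F1" | "e \<in># F2"
      using e by auto
    then show ?thesis
    proof cases
      case 1
      then show ?thesis
        using colorable_union[OF glued F] by simp
    next
      case 2
      then show ?thesis
        using side[OF glued crit1 F(2)] by simp
    next
      case 3
      then show ?thesis
        using side[OF glued_sym[OF glued] crit2 F(1)] by (simp add: insert_commute union_commute)
    qed
  qed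
  moreover have "\<not> colorable m (add_mset {u1, u2} (F1 + F2))"
    using colorable_join_split[of m u1 u2 F1 F2 w] crit1 crit2 by (auto simp: edge_critical_def)
  ultimately show ?thesis
    by (simp add: edge_critical_def)
qed

text \<open>Neither side is colourable, since otherwise the join would be. After an edge of
  \<open>F1\<close> is deleted the join is colourable, hence one side is, and it cannot be the
  untouched second one.\<close>

lemma edge_critical_join_left:
  assumes glued: "glued V1 V2 u1 u2 w F1 F2"
    and crit: "edge_critical m (add_mset {u1, u2} (F1 + F2))"
  shows "edge_critical m (add_mset {u1, w} F1)"
proof -
  have "colorable m (F1 + F2)"
    using crit by (auto simp: edge_critical_def)
  then have F: "colorable m F1" "colorable m F2"
    by (auto intro: colorable_subset)
  have nc: "\<not> colorable m (add_mset {u1, u2} (F1 + F2))"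
    using crit by (simp add: edge_critical_def)
  have nc1: "\<not> colorable m (add_mset {u1, w} F1)"
    using colorable_join[OF glued _ F(2)] nc by blast
  have nc2: "\<not> colorable m (add_mset {u2, w} F2)"
    using colorable_join[OF glued_sym[OF glued] _ F(1)] nc
    by (auto simp: insert_commute union_commute)
  have "colorable m (add_mset {u1, w} F1 - {#e#})" if e: "e \<in># F1" for e
  proof -
    have "colorable m (add_mset {u1, u2} (F1 + F2) - {#e#})"
      using crit e by (auto simp: edge_critical_def)
    then have "colorable m (add_mset {u1, w} (F1 - {#e#}))"
      using colorable_join_split[of m u1 u2 "F1 - {#e#}" F2 w] nc2
      by (simp add: add_mset_union_diff[OF e])
    then show ?thesis
      using add_mset_union_diff[OF e, of _ "{#}"] by simp
  qed
  then show ?thesis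
    using F(1) nc1 by (auto simp: edge_critical_def)
qed

text \<open>A good colouring of \<open>F\<close> must connect \<open>u\<close> and \<open>w\<close>
  by a monochromatic path; its last edge covers \<open>w\<close>. Thus \<open>w\<close> does not
  become isolated in the join.\<close>

lemma edge_critical_covers_end:
  assumes "edge_critical m (add_mset {u, w} F)" and "u \<noteq> w"
  shows "w \<in> \<Union>(set_mset F)"
proof -
  obtain c where c: "\<forall>x. c x < m" "acyc (mono_edges c F)"
    using assms(1) by (auto simp: edge_critical_def colorable_def)
  have "\<not> acyc (mono_edges c (add_mset {u, w} F))"
    using assms(1) c(1) unfolding edge_critical_def colorable_def by blast
  then have "(u, w) \<in> conn (mono_edges c F)"
    using c(2) by (auto simp: acyc_add_mset split: if_splits)
  from conn_end[OF this assms(2)] show ?thesis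
    by (auto simp: in_mono_edges_iff)
qed

section \<open>The join as a gluing of renamed graphs\<close>

text \<open>The identification map moves only \<open>v1\<close> in \<open>G1\<close> and only
  \<open>v2\<close> in \<open>G2\<close>, to a name no other vertex has. It is therefore injective
  on each graph, and the join is a gluing of two isomorphic copies.\<close>

lemma hajos_join_glued:
  assumes "multigraph G1" and "multigraph G2"
    and "disjoint_graphs G1 G2" and "hajos_join G1 G2 G"
  obtains f u1 u2 w F1 F2 where
    "inj_on f (verts G1)" "inj_on f (verts G2)"
    "glued (f ` verts G1) (f ` verts G2) u1 u2 w F1 F2"
    "image_mset (image f) (edges G1) = add_mset {u1, w} F1"
    "image_mset (image f) (edges G2) = add_mset {u2, w} F2"
    "verts G = f ` verts G1 \<union> f ` verts G2"
    "edges G = add_mset {u1, u2} (F1 + F2)"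
proof -
  obtain u1 v1 u2 v2 w where
    1: "u1 \<in> verts G1" "v1 \<in> verts G1" "u1 \<noteq> v1" "{u1, v1} \<in># edges G1" and
    2: "u2 \<in> verts G2" "v2 \<in> verts G2" "u2 \<noteq> v2" "{u2, v2} \<in># edges G2" and
    w: "w \<notin> (verts G1 \<union> verts G2) - {v1, v2}" and
    G: "G = add_edge {u1, u2} (identify v1 v2 w
              (delete_edge {u1, v1} (delete_edge {u2, v2} (graph_union G1 G2))))"
    using assms(4) unfolding hajos_join_def by blast
  define f where "f z = (if z = v1 \<or> z = v2 then w else z)" for z
  obtain D1 D2 where D: "edges G1 = add_mset {u1, v1} D1" "edges G2 = add_mset {u2, v2} D2"
    using 1(4) 2(4) by (metis insert_DiffM)
  define F1 F2 where "F1 = image_mset (image f) D1" and "F2 = image_mset (image f) D2"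
  have disj: "verts G1 \<inter> verts G2 = {}"
    using assms(3) by (simp add: disjoint_graphs_def)
  have f: "f u1 = u1" "f u2 = u2" "f v1 = w" "f v2 = w"
    using 1 2 disj by (auto simp: f_def)
  have inj: "inj_on f (verts G1)" "inj_on f (verts G2)"
    using 1 2 w disj by (auto simp: inj_on_def f_def)
  have uw: "u1 \<noteq> w" "u2 \<noteq> w"
    using 1 2 w disj by auto
  have cap: "f ` verts G1 \<inter> f ` verts G2 = {w}"
    using 1 2 w disj by (auto simp: f_def image_iff split: if_splits)
  have F: "\<forall>e\<in>#image_mset (image f) D. e \<subseteq> f ` verts H \<and> card e = 2"
    if H: "multigraph H" "inj_on f (verts H)" "D \<subseteq># edges H" for D and H :: "'a mgraph"
  proof
    fix e
    assume "e \<in># image_mset (image f) D"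
    then obtain d where d: "e = f ` d" "d \<in># edges H"
      using H(3) by (auto dest: mset_subset_eqD)
    then have "d \<subseteq> verts H" "card d = 2"
      using H(1) by (auto simp: multigraph_def)
    then show "e \<subseteq> f ` verts H \<and> card e = 2"
      using d(1) H(2) by (auto simp: card_image inj_on_subset)
  qed
  have "glued (f ` verts G1) (f ` verts G2) u1 u2 w F1 F2"
    using cap uw F[OF assms(1) inj(1), of D1] F[OF assms(2) inj(2), of D2] D
      imageI[OF 1(1), of f] imageI[OF 2(1), of f] f
    by (auto simp: glued_def F1_def F2_def)
  moreover have "verts G = f ` verts G1 \<union> f ` verts G2"
    by (simp add: G add_edge_def identify_def delete_edge_def graph_union_def Let_def f_def[abs_def] image_Un)
  moreover have "edges G = add_mset {u1, u2} (F1 + F2)"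
    by (simp add: G add_edge_def identify_def delete_edge_def graph_union_def Let_def f_def[abs_def]
        D F1_def F2_def)
  moreover have "image_mset (image f) (edges G1) = add_mset {u1, w} F1"
    "image_mset (image f) (edges G2) = add_mset {u2, w} F2"
    by (simp_all add: D F1_def F2_def f)
  ultimately show thesis
    using that inj by metis
qed

section \<open>The four claims, transferred to edge multisets\<close>

theorem theorem13:
  fixes G G1 G2 :: "'a mgraph"
  assumes "multigraph G1" and "multigraph G2"
    and "verts G1 \<noteq> {}" and "verts G2 \<noteq> {}"
    and "disjoint_graphs G1 G2"
    and "hajos_join G1 G2 G"
  shows "\<chi>\<^sub>2 G \<ge> min (\<chi>\<^sub>2 G1) (\<chi>\<^sub>2 G2)
    \<and> (\<forall>k\<ge>2. \<chi>\<^sub>2 G1 = k \<and> \<chi>\<^sub>2 G2 = k \<longrightarrow> \<chi>\<^sub>2 G = k)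
    \<and> (\<forall>k\<ge>2. G1 \<in> Cri\<^sub>2 k \<and> G2 \<in> Cri\<^sub>2 k \<longrightarrow> G \<in> Cri\<^sub>2 k)
    \<and> (\<forall>k\<ge>2. G \<in> Cri\<^sub>2 k \<longrightarrow> G1 \<in> Cri\<^sub>2 k \<and> G2 \<in> Cri\<^sub>2 k)"
proof -
  obtain f u1 u2 w F1 F2 where inj: "inj_on f (verts G1)" "inj_on f (verts G2)"
    and glued: "glued (f ` verts G1) (f ` verts G2) u1 u2 w F1 F2"
    and E1: "image_mset (image f) (edges G1) = add_mset {u1, w} F1"
    and E2: "image_mset (image f) (edges G2) = add_mset {u2, w} F2"
    and V: "verts G = f ` verts G1 \<union> f ` verts G2"
    and E: "edges G = add_mset {u1, u2} (F1 + F2)"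
    using hajos_join_glued[OF assms(1,2,5,6)] by blast
  have sub: "\<forall>e\<in>#edges G1. e \<subseteq> verts G1" "\<forall>e\<in>#edges G2. e \<subseteq> verts G2"
    using assms(1,2) by (auto simp: multigraph_def)
  have G: "multigraph G"
    using glued assms(1,2) by (auto simp: multigraph_def V E glued_def card_2_iff; blast)
  have col1: "\<chi>\<^sub>2 G1 \<le> k \<longleftrightarrow> colorable k (add_mset {u1, w} F1)" if "k \<ge> 1" for k
    using point_arboricity_le_iff[OF assms(1) that] colorable_image_iff[OF inj(1) sub(1)] E1 by simp
  have col2: "\<chi>\<^sub>2 G2 \<le> k \<longleftrightarrow> colorable k (add_mset {u2, w} F2)" if "k \<ge> 1" for k
    using point_arboricity_le_iff[OF assms(2) that] colorable_image_iff[OF inj(2) sub(2)] E2 by simp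
  have col: "\<chi>\<^sub>2 G \<le> k \<longleftrightarrow> colorable k (add_mset {u1, u2} (F1 + F2))" if "k \<ge> 1" for k
    using point_arboricity_le_iff[OF G that] E by simp
  have a: "\<chi>\<^sub>2 G \<ge> min (\<chi>\<^sub>2 G1) (\<chi>\<^sub>2 G2)"
  proof -
    \<comment> \<open>The join has a vertex, so the number of colours
      \<open>\<chi>\<^sub>2 G\<close> is positive and \<open>col\<close>, \<open>col1\<close>,
      \<open>col2\<close> apply to it.\<close>
    have "\<chi>\<^sub>2 G \<ge> 1"
      using G V assms(3) by (intro point_arboricity_pos) auto
    then show ?thesis
      using col[of "\<chi>\<^sub>2 G"] col1[of "\<chi>\<^sub>2 G"] col2[of "\<chi>\<^sub>2 G"] colorable_join_split[of "\<chi>\<^sub>2 G" u1 u2 F1 F2 w]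
      by auto
  qed
  have b: "\<chi>\<^sub>2 G = k" if "k \<ge> 2" "\<chi>\<^sub>2 G1 = k" "\<chi>\<^sub>2 G2 = k" for k
  proof -
    have "colorable k (add_mset {u1, w} F1)" "colorable k (add_mset {u2, w} F2)"
      using col1[of k] col2[of k] that by auto
    then have "colorable k (add_mset {u1, u2} (F1 + F2))"
      by (intro colorable_join[OF glued]) (auto intro: colorable_subset)
    then show ?thesis
      using col[of k] a that by auto
  qed
  have cover: "f ` verts H \<subseteq> \<Union>(set_mset (image_mset (image f) (edges H)))
      \<longleftrightarrow> verts H \<subseteq> \<Union>(set_mset (edges H))"
    if "multigraph H" "inj_on f (verts H)" for H :: "'a mgraph"
  proof -
    have "\<Union>(set_mset (image_mset (image f) (edges H))) = f ` \<Union>(set_mset (edges H))"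
      by auto
    moreover have "\<Union>(set_mset (edges H)) \<subseteq> verts H"
      using that(1) by (auto simp: multigraph_def)
    ultimately show ?thesis
      using inj_on_image_mem_iff[OF that(2)] by blast
  qed
  have cri1: "G1 \<in> Cri\<^sub>2 (Suc m) \<longleftrightarrow>
      edge_critical m (add_mset {u1, w} F1) \<and> f ` verts G1 \<subseteq> \<Union>(set_mset (add_mset {u1, w} F1))"
    if "m \<ge> 1" for m
    using Cri2_Suc_iff[OF assms(1) that] edge_critical_image_iff[OF inj(1) sub(1)]
      cover[OF assms(1) inj(1)] unfolding E1 by simp
  have cri2: "G2 \<in> Cri\<^sub>2 (Suc m) \<longleftrightarrow>
      edge_critical m (add_mset {u2, w} F2) \<and> f ` verts G2 \<subseteq> \<Union>(set_mset (add_mset {u2, w} F2))"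
    if "m \<ge> 1" for m
    using Cri2_Suc_iff[OF assms(2) that] edge_critical_image_iff[OF inj(2) sub(2)]
      cover[OF assms(2) inj(2)] unfolding E2 by simp
  have cri: "G \<in> Cri\<^sub>2 (Suc m) \<longleftrightarrow> edge_critical m (add_mset {u1, u2} (F1 + F2))
      \<and> f ` verts G1 \<union> f ` verts G2 \<subseteq> \<Union>(set_mset (add_mset {u1, u2} (F1 + F2)))"
    if "m \<ge> 1" for m
    using Cri2_Suc_iff[OF G that] unfolding V E .
  have c: "G \<in> Cri\<^sub>2 (Suc m)" if "m \<ge> 1" "G1 \<in> Cri\<^sub>2 (Suc m)" "G2 \<in> Cri\<^sub>2 (Suc m)" for m
  proof -
    have crit: "edge_critical m (add_mset {u1, w} F1)" "edge_critical m (add_mset {u2, w} F2)"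
      using that cri1 cri2 by auto
    \<comment> \<open>The join loses both edges at \<open>w\<close> but \<open>F1\<close> still
      covers it; \<open>u1\<close> and \<open>u2\<close> are covered by the new edge.\<close>
    have "w \<in> \<Union>(set_mset F1)"
      using glued by (intro edge_critical_covers_end[OF crit(1)]) (auto simp: glued_def)
    moreover have "f ` verts G1 \<subseteq> {u1, w} \<union> \<Union>(set_mset F1)" "f ` verts G2 \<subseteq> {u2, w} \<union> \<Union>(set_mset F2)"
      using that cri1[of m] cri2[of m] by auto
    ultimately have "f ` verts G1 \<union> f ` verts G2 \<subseteq> \<Union>(set_mset (add_mset {u1, u2} (F1 + F2)))"
      by auto
    then show ?thesis
      using cri[OF that(1)] edge_critical_join[OF glued crit] by blast
  qed
  have d: "G1 \<in> Cri\<^sub>2 (Suc m) \<and> G2 \<in> Cri\<^sub>2 (Suc m)" if "m \<ge> 1" "G \<in> Cri\<^sub>2 (Suc m)" for m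
  proof -
    have crit: "edge_critical m (add_mset {u1, u2} (F1 + F2))"
      and all: "f ` verts G1 \<union> f ` verts G2 \<subseteq> {u1, u2} \<union> \<Union>(set_mset F1) \<union> \<Union>(set_mset F2)"
      using that cri by auto
    have "edge_critical m (add_mset {u1, w} F1)"
      using edge_critical_join_left[OF glued crit] .
    moreover have "edge_critical m (add_mset {u2, w} F2)"
      using crit by (intro edge_critical_join_left[OF glued_sym[OF glued]])
        (simp add: insert_commute union_commute)
    moreover have supp: "\<Union>(set_mset F1) \<subseteq> f ` verts G1" "\<Union>(set_mset F2) \<subseteq> f ` verts G2"
      "f ` verts G1 \<inter> f ` verts G2 = {w}" "u1 \<in> f ` verts G1" "u2 \<in> f ` verts G2"
      using glued by (auto simp: glued_def)
    \<comment> \<open>\<open>b\<close> and the edges in \<open>B\<close> lie on the other side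
      \<open>Y\<close>, so within \<open>X\<close> they can cover only \<open>w\<close>.\<close>
    have part: "X \<subseteq> {a, w} \<union> A"
      if "X \<union> Y \<subseteq> {a, b} \<union> A \<union> B" "B \<subseteq> Y" "X \<inter> Y = {w}" "b \<in> Y" for X Y A B :: "'a set" and a b
      using that by auto
    have "f ` verts G1 \<subseteq> {u1, w} \<union> \<Union>(set_mset F1)"
      by (rule part[OF all supp(2,3,5)])
    moreover have "f ` verts G2 \<subseteq> {u2, w} \<union> \<Union>(set_mset F2)"
      using all supp(3) by (intro part[OF _ supp(1) _ supp(4)]) (simp_all add: Un_ac insert_commute Int_commute)
    ultimately show ?thesis
      using cri1[OF that(1)] cri2[OF that(1)] by simp
  qed
  have Suc: "\<exists>m\<ge>1. k = Suc m" if "k \<ge> 2" for k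
    using that by (intro exI[of _ "k - 1"]) auto
  have "\<forall>k\<ge>2. \<chi>\<^sub>2 G1 = k \<and> \<chi>\<^sub>2 G2 = k \<longrightarrow> \<chi>\<^sub>2 G = k"
    using b by simp
  moreover have "\<forall>k\<ge>2. G1 \<in> Cri\<^sub>2 k \<and> G2 \<in> Cri\<^sub>2 k \<longrightarrow> G \<in> Cri\<^sub>2 k"
    using c Suc by blast
  moreover have "\<forall>k\<ge>2. G \<in> Cri\<^sub>2 k \<longrightarrow> G1 \<in> Cri\<^sub>2 k \<and> G2 \<in> Cri\<^sub>2 k"
    using d Suc by blast
  ultimately show ?thesis
    using a by (intro conjI)
qed

end
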